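(* Let $K$ be an algebraically closed field of characteristic zero and $A$ a finite-dimensional semisimple associative $K$-algebra. If $M$ is a finite-dimensional $A$-$A$-bimodule with a balanced symplectic form $\omega$, then any maximal isotropic sub-bimodule $S$ of $M$ has an isotropic bimodule complement (that is, there is an isotropic sub-bimodule $D$ of $M$ with $M=S\oplus D$). Both $S$ and the complement are Lagrangian. Moreover there is an isomorphism of bimodules $M\cong S\oplus S^*$ under which the symplectic form is given by $$\omega((s,f),(s',f'))=f(s')-f'(s).$$
   Context: Bimodules are $K$-linear with $K$ acting centrally. A symplectic form on $M$ is a non-degenerate alternating $K$-bilinear form $\omega:M\times M\to K$; it is balanced if $\omega(x,ay)=\omega(xa,y)$ for all $a\in A$, $x,y\in M$. For a subspace $U\subseteq M$, $U^\perp=\{m\in M\mid\omega(m,u)=0\text{ for all }u\in U\}$; $U$ is isotropic if $U\subseteq U^\perp$, and Lagrangian if $U=U^\perp$. A maximal isotropic sub-bimodule is a sub-bimodule that is isotropic and is maximal under inclusion among isotropic sub-bimodules. $S^*=\mathrm{Hom}_K(S,K)$ is an $A$-$A$-bimodule via $(afb)(s)=f(bsa)$. *)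

theory Defs
  imports
    "HOL-Computational_Algebra.Polynomial"
    "HOL-Library.Function_Algebras"
    "HOL-Library.Product_Plus"
    "HOL-Library.FuncSet"
begin

section \<open>Algebras\<close>

text \<open>
  Algebras are associative and unital. The sort \<open>{ring, monoid_mult}\<close> is used instead of
  \<open>ring_1\<close> because the latter includes \<open>0 \<noteq> 1\<close> and would exclude the zero algebra.
\<close>

locale assoc_algebra = vector_space scale
  for scale :: "'k::field \<Rightarrow> 'a::{ring, monoid_mult} \<Rightarrow> 'a" +
  assumes scale_mult_left: "scale c a * b = scale c (a * b)"
    and scale_mult_right: "a * scale c b = scale c (a * b)"

definition finite_dim :: "('k::field \<Rightarrow> 'v::ab_group_add \<Rightarrow> 'v) \<Rightarrow> bool" where
  "finite_dim scale \<longleftrightarrow> (\<exists>B. finite_dimensional_vector_space scale B)"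

definition left_ideal :: "('k::field \<Rightarrow> 'a::{ring, monoid_mult} \<Rightarrow> 'a) \<Rightarrow> 'a set \<Rightarrow> bool" where
  "left_ideal scale L \<longleftrightarrow> module.subspace scale L \<and> (\<forall>a. \<forall>x\<in>L. a * x \<in> L)"

definition simple_left_ideal :: "('k::field \<Rightarrow> 'a::{ring, monoid_mult} \<Rightarrow> 'a) \<Rightarrow> 'a set \<Rightarrow> bool" where
  "simple_left_ideal scale L \<longleftrightarrow> left_ideal scale L \<and> L \<noteq> {0} \<and>
     (\<forall>L'. left_ideal scale L' \<and> L' \<subseteq> L \<longrightarrow> L' = {0} \<or> L' = L)"

text \<open>
  Semisimple: the left regular module is an internal direct sum of simple submodules. A finite
  family suffices since the algebra is unital (and the empty family yields the zero algebra);
  the summands, being nonzero with direct sum, are pairwise distinct, so they can be indexed by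
  themselves.
\<close>

definition semisimple_algebra :: "('k::field \<Rightarrow> 'a::{ring, monoid_mult} \<Rightarrow> 'a) \<Rightarrow> bool" where
  "semisimple_algebra scale \<longleftrightarrow>
     (\<exists>F. finite F \<and> (\<forall>L\<in>F. simple_left_ideal scale L) \<and>
          (\<forall>a. \<exists>!x. x \<in> (\<Pi>\<^sub>E L\<in>F. L) \<and> a = (\<Sum>L\<in>F. x L)))"

section \<open>Bimodules\<close>

text \<open>
  The last two axioms say that \<open>K\<close> acts centrally, through its scalar action on \<open>M\<close>; together
  with the module axioms they make both actions \<open>K\<close>-bilinear.
\<close>

locale bimodule =
  assoc_algebra scaleA + M: vector_space scaleM
  for scaleA :: "'k::field \<Rightarrow> 'a::{ring, monoid_mult} \<Rightarrow> 'a"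
    and scaleM :: "'k \<Rightarrow> 'm::ab_group_add \<Rightarrow> 'm" +
  fixes lact :: "'a \<Rightarrow> 'm \<Rightarrow> 'm" and ract :: "'m \<Rightarrow> 'a \<Rightarrow> 'm"
  assumes lact_add_left: "lact (a + b) x = lact a x + lact b x"
    and lact_add_right: "lact a (x + y) = lact a x + lact a y"
    and lact_mult: "lact (a * b) x = lact a (lact b x)"
    and lact_one: "lact 1 x = x"
    and ract_add_left: "ract (x + y) a = ract x a + ract y a"
    and ract_add_right: "ract x (a + b) = ract x a + ract x b"
    and ract_mult: "ract x (a * b) = ract (ract x a) b"
    and ract_one: "ract x 1 = x"
    and lact_ract: "lact a (ract x b) = ract (lact a x) b"
    and lact_scalar: "lact (scaleA c 1) x = scaleM c x"
    and ract_scalar: "ract x (scaleA c 1) = scaleM c x"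

definition sub_bimodule ::
  "('k::field \<Rightarrow> 'm::ab_group_add \<Rightarrow> 'm) \<Rightarrow> ('a \<Rightarrow> 'm \<Rightarrow> 'm) \<Rightarrow> ('m \<Rightarrow> 'a \<Rightarrow> 'm) \<Rightarrow> 'm set \<Rightarrow> bool" where
  "sub_bimodule scaleM lact ract S \<longleftrightarrow>
     module.subspace scaleM S \<and> (\<forall>a. \<forall>x\<in>S. lact a x \<in> S \<and> ract x a \<in> S)"

definition internal_direct_sum :: "'m::ab_group_add set \<Rightarrow> 'm set \<Rightarrow> bool" where
  "internal_direct_sum S D \<longleftrightarrow> S \<inter> D = {0} \<and> {s + d |s d. s \<in> S \<and> d \<in> D} = UNIV"

section \<open>Symplectic forms\<close>

definition symplectic_form ::
  "('k::field \<Rightarrow> 'm::ab_group_add \<Rightarrow> 'm) \<Rightarrow> ('m \<Rightarrow> 'm \<Rightarrow> 'k) \<Rightarrow> bool" where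
  "symplectic_form scaleM \<omega> \<longleftrightarrow>
     (\<forall>x. Vector_Spaces.linear scaleM (*) (\<lambda>y. \<omega> x y)) \<and>
     (\<forall>y. Vector_Spaces.linear scaleM (*) (\<lambda>x. \<omega> x y)) \<and>
     (\<forall>x. \<omega> x x = 0) \<and>
     (\<forall>x. (\<forall>y. \<omega> x y = 0) \<longrightarrow> x = 0)"

definition balanced ::
  "('a \<Rightarrow> 'm \<Rightarrow> 'm) \<Rightarrow> ('m \<Rightarrow> 'a \<Rightarrow> 'm) \<Rightarrow> ('m \<Rightarrow> 'm \<Rightarrow> 'k) \<Rightarrow> bool" where
  "balanced lact ract \<omega> \<longleftrightarrow> (\<forall>a x y. \<omega> x (lact a y) = \<omega> (ract x a) y)"

definition perp :: "('m \<Rightarrow> 'm \<Rightarrow> 'k::zero) \<Rightarrow> 'm set \<Rightarrow> 'm set" where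
  "perp \<omega> U = {m. \<forall>u\<in>U. \<omega> m u = 0}"

definition isotropic :: "('m \<Rightarrow> 'm \<Rightarrow> 'k::zero) \<Rightarrow> 'm set \<Rightarrow> bool" where
  "isotropic \<omega> U \<longleftrightarrow> U \<subseteq> perp \<omega> U"

definition lagrangian :: "('m \<Rightarrow> 'm \<Rightarrow> 'k::zero) \<Rightarrow> 'm set \<Rightarrow> bool" where
  "lagrangian \<omega> U \<longleftrightarrow> U = perp \<omega> U"

definition maximal_isotropic_sub_bimodule ::
  "('k::field \<Rightarrow> 'm::ab_group_add \<Rightarrow> 'm) \<Rightarrow> ('a \<Rightarrow> 'm \<Rightarrow> 'm) \<Rightarrow> ('m \<Rightarrow> 'a \<Rightarrow> 'm) \<Rightarrow>
   ('m \<Rightarrow> 'm \<Rightarrow> 'k) \<Rightarrow> 'm set \<Rightarrow> bool" where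
  "maximal_isotropic_sub_bimodule scaleM lact ract \<omega> S \<longleftrightarrow>
     sub_bimodule scaleM lact ract S \<and> isotropic \<omega> S \<and>
     (\<forall>T. sub_bimodule scaleM lact ract T \<and> isotropic \<omega> T \<and> S \<subseteq> T \<longrightarrow> T = S)"

section \<open>The dual of a sub-bimodule and the bimodule \<open>S \<oplus> S\<^sup>*\<close>\<close>

text \<open>
  An element of \<open>S\<^sup>* = Hom\<^sub>K(S, K)\<close> is represented by the function on the ambient type that extends
  it by the value \<open>0\<close> outside \<open>S\<close> (a set-theoretic extension, not a linear one), so that distinct
  functionals on \<open>S\<close> are distinct functions and addition and scaling are pointwise.
\<close>

definition dual_space ::
  "('k::field \<Rightarrow> 'm::ab_group_add \<Rightarrow> 'm) \<Rightarrow> 'm set \<Rightarrow> ('m \<Rightarrow> 'k) set" where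
  "dual_space scaleM S = {f.
     (\<forall>x\<in>S. \<forall>y\<in>S. f (x + y) = f x + f y) \<and>
     (\<forall>c. \<forall>x\<in>S. f (scaleM c x) = c * f x) \<and>
     (\<forall>x. x \<notin> S \<longrightarrow> f x = 0)}"

text \<open>The left and right parts of the action \<open>(a f b)(s) = f (b s a)\<close>.\<close>

definition dual_lact :: "('m \<Rightarrow> 'a \<Rightarrow> 'm) \<Rightarrow> 'm set \<Rightarrow> 'a \<Rightarrow> ('m \<Rightarrow> 'k::zero) \<Rightarrow> 'm \<Rightarrow> 'k" where
  "dual_lact ract S a f = (\<lambda>s. if s \<in> S then f (ract s a) else 0)"

definition dual_ract :: "('a \<Rightarrow> 'm \<Rightarrow> 'm) \<Rightarrow> 'm set \<Rightarrow> ('m \<Rightarrow> 'k::zero) \<Rightarrow> 'a \<Rightarrow> 'm \<Rightarrow> 'k" where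
  "dual_ract lact S f b = (\<lambda>s. if s \<in> S then f (lact b s) else 0)"

text \<open>
  An isomorphism of bimodules from the ambient bimodule \<open>M\<close> onto \<open>S \<oplus> S\<^sup>*\<close>, whose carrier is
  \<open>S \<times> S\<^sup>*\<close> with componentwise operations.
\<close>

definition iso_sum_dual ::
  "('k::field \<Rightarrow> 'm::ab_group_add \<Rightarrow> 'm) \<Rightarrow> ('a \<Rightarrow> 'm \<Rightarrow> 'm) \<Rightarrow> ('m \<Rightarrow> 'a \<Rightarrow> 'm) \<Rightarrow>
   'm set \<Rightarrow> ('m \<Rightarrow> 'm \<times> ('m \<Rightarrow> 'k)) \<Rightarrow> bool" where
  "iso_sum_dual scaleM lact ract S \<phi> \<longleftrightarrow>
     bij_betw \<phi> UNIV (S \<times> dual_space scaleM S) \<and>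
     (\<forall>x y. \<phi> (x + y) = \<phi> x + \<phi> y) \<and>
     (\<forall>c x. \<phi> (scaleM c x) = (case \<phi> x of (s, f) \<Rightarrow> (scaleM c s, \<lambda>t. c * f t))) \<and>
     (\<forall>a x. \<phi> (lact a x) = (case \<phi> x of (s, f) \<Rightarrow> (lact a s, dual_lact ract S a f))) \<and>
     (\<forall>a x. \<phi> (ract x a) = (case \<phi> x of (s, f) \<Rightarrow> (ract s a, dual_ract lact S f a)))"

end

theory Submission
  imports Defs
begin

text \<open>
  Let \<open>e, f\<close> be idempotents of \<open>A\<close> that generate simple left ideals. By Schur's lemma over an
  algebraically closed field, \<open>f A e\<close> is spanned by a single element \<open>g\<close>; if \<open>g \<noteq> 0\<close>, there is
  \<open>c \<in> e A f\<close> with \<open>c g = e\<close> and \<open>g c = f\<close> (\<open>peirce_component_cyclic\<close>,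
  \<open>peirce_component_invertible\<close>). Two facts about an element \<open>x = e x f\<close> of \<open>M\<close> follow.

  The sub-bimodule \<open>A x A\<close> is isotropic. Balancedness moves all algebra elements to one side and
  reduces the claim to \<open>\<omega>(x, a x b) = 0\<close>; here \<open>a\<close> and \<open>b\<close> may be replaced by \<open>f a e\<close> and
  \<open>f b e\<close>, which are multiples of \<open>g\<close>, and \<open>\<omega>(x, g x g) = \<omega>(x g, x g) = 0\<close>.

  The sub-bimodule \<open>A x A\<close> is zero or simple: a nonzero component \<open>e' y f'\<close> of one of its elements
  is a multiple of \<open>g x h\<close> with \<open>g\<close> spanning \<open>e' A e\<close> and \<open>h\<close> spanning \<open>f A f'\<close>, and inverting
  \<open>g\<close> and \<open>h\<close> recovers \<open>x\<close>.

  As \<open>1\<close> is a sum of such idempotents, every element of \<open>M\<close> is a sum of elements of this kind.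
  Hence, whenever a sub-bimodule \<open>R\<close> is not contained in a sub-bimodule \<open>Q\<close>, there is a nonzero
  isotropic sub-bimodule of \<open>R\<close> that meets \<open>Q\<close> trivially (\<open>isotropic_sub_bimodule_avoiding\<close>).
  This is applied twice. With \<open>R = S\<^sup>\<bottom>\<close> and \<open>Q = S\<close> it shows that a maximal isotropic \<open>S\<close> is
  Lagrangian, since otherwise \<open>S\<close> could be enlarged. With \<open>R = D\<^sup>\<bottom>\<close> and \<open>Q = S + D\<close>, where \<open>D\<close> is
  of largest dimension among the isotropic sub-bimodules that meet \<open>S\<close> trivially, it shows
  \<open>D\<^sup>\<bottom> \<subseteq> S + D\<close>. Every element of \<open>(S + D)\<^sup>\<bottom>\<close> is then orthogonal to \<open>D\<^sup>\<bottom>\<close>, so it lies in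
  \<open>D\<^sup>\<bottom>\<^sup>\<bottom> = D\<close>, and it lies in \<open>S\<^sup>\<bottom> = S\<close>; so \<open>(S + D)\<^sup>\<bottom> = 0\<close> and \<open>S + D = M\<close>.

  Finally, for \<open>M = S \<oplus> D\<close> with both summands isotropic, the isomorphism onto \<open>S \<oplus> S\<^sup>*\<close> sends
  \<open>x = s + d\<close> to \<open>s\<close> together with the restriction of \<open>\<omega>(x, \<cdot>)\<close> to \<open>S\<close>, which is also the
  restriction of \<open>\<omega>(d, \<cdot>)\<close>.
\<close>

section \<open>Linear algebra\<close>

lemma (in finite_dimensional_vector_space) sequence_meets_span_of_predecessors:
  "\<exists>n. x n \<in> span (x ` {..<n})" for x :: "nat \<Rightarrow> 'b"
proof (rule ccontr)
  assume "\<not> ?thesis"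
  then have new: "x n \<notin> span (x ` {..<n})" for n
    by blast
  have "independent (x ` {..<n}) \<and> card (x ` {..<n}) = n" for n
  proof (induction n)
    case 0
    then show ?case by (simp add: independent_empty)
  next
    case (Suc n)
    have "x n \<notin> x ` {..<n}"
      using new[of n] span_base[of "x n"] by metis
    then show ?case
      using Suc new[of n] by (simp add: lessThan_Suc independent_insertI)
  qed
  from this[of "Suc (card Basis)"] independent_span_bound[OF finite_Basis, of "x ` {..<Suc (card Basis)}"]
  show False by (simp add: span_Basis)
qed

text \<open>
  Some nonzero polynomial \<open>p\<close> satisfies \<open>p(T) v = 0\<close>, because the iterates \<open>T\<^sup>n v\<close> cannot all be
  independent. Take one of least degree and split off a root: \<open>p = (X - z) q\<close>. Then \<open>q(T) v\<close> is
  nonzero by minimality, and it is an eigenvector for \<open>z\<close>.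
\<close>

lemma eigenvector_in_invariant_subspace:
  fixes scale :: "'k::alg_closed_field \<Rightarrow> 'v::ab_group_add \<Rightarrow> 'v"
  assumes "finite_dim scale" and lin: "Vector_Spaces.linear scale scale T"
    and U: "module.subspace scale U" and inv: "\<And>u. u \<in> U \<Longrightarrow> T u \<in> U"
    and v: "v \<in> U" "v \<noteq> 0"
  obtains w c where "w \<in> U" "w \<noteq> 0" "T w = scale c w"
proof -
  from assms(1) obtain B where "finite_dimensional_vector_space scale B"
    by (auto simp: finite_dim_def)
  then interpret V: finite_dimensional_vector_space scale B .
  interpret T: Vector_Spaces.linear scale scale T by (rule lin)
  \<comment> \<open>\<open>ev p = p(T) v\<close>, evaluated by Horner's scheme\<close>
  define ev where "ev p = fold_coeffs (\<lambda>a w. scale a v + T w) p 0" for p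
  have ev_0 [simp]: "ev 0 = 0"
    by (simp add: ev_def)
  have ev_pCons [simp]: "ev (pCons a p) = scale a v + T (ev p)" for a p
    by (cases "p = 0 \<and> a = 0") (auto simp: ev_def T.zero)
  have ev_add: "ev (p + q) = ev p + ev q" for p q
    by (induction p q rule: poly_induct2) (simp_all add: V.scale_left_distrib T.add)
  have ev_smult: "ev (smult c p) = scale c (ev p)" for c p
    by (induction p) (simp_all add: V.scale_right_distrib T.scale)
  have ev_diff: "ev (p - q) = ev p - ev q" for p q
    using ev_add[of "p - q" q] by simp
  have ev_in_U: "ev p \<in> U" for p
    by (induction p) (simp_all add: V.subspace_0 V.subspace_add V.subspace_scale U v inv)
  \<comment> \<open>\<open>ev (monom 1 n)\<close> is \<open>T\<^sup>n v\<close>; spans of earlier iterates consist of values at polynomials of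
    degree below \<open>n\<close>.\<close>
  obtain n where n: "ev (monom 1 n) \<in> V.span ((\<lambda>i. ev (monom 1 i)) ` {..<n})"
    using V.sequence_meets_span_of_predecessors[of "\<lambda>i. ev (monom 1 i)"] by blast
  have "V.span ((\<lambda>i. ev (monom 1 i)) ` {..<n}) \<subseteq> ev ` {p. \<forall>i\<ge>n. coeff p i = 0}"
  proof (rule V.span_minimal)
    show "V.subspace (ev ` {p. \<forall>i\<ge>n. coeff p i = 0})"
    proof (rule V.subspaceI)
      show "0 \<in> ev ` {p. \<forall>i\<ge>n. coeff p i = 0}"
        by (rule image_eqI[of _ _ 0]) auto
    next
      fix x y assume "x \<in> ev ` {p. \<forall>i\<ge>n. coeff p i = 0}" "y \<in> ev ` {p. \<forall>i\<ge>n. coeff p i = 0}"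
      then obtain p q where "x = ev p" "\<forall>i\<ge>n. coeff p i = 0" "y = ev q" "\<forall>i\<ge>n. coeff q i = 0"
        by blast
      then show "x + y \<in> ev ` {p. \<forall>i\<ge>n. coeff p i = 0}"
        by (intro image_eqI[of _ _ "p + q"]) (auto simp: ev_add)
    next
      fix c x assume "x \<in> ev ` {p. \<forall>i\<ge>n. coeff p i = 0}"
      then obtain p where "x = ev p" "\<forall>i\<ge>n. coeff p i = 0"
        by blast
      then show "scale c x \<in> ev ` {p. \<forall>i\<ge>n. coeff p i = 0}"
        by (intro image_eqI[of _ _ "smult c p"]) (auto simp: ev_smult)
    qed
  qed auto
  with n obtain q where q: "ev (monom 1 n) = ev q" "coeff q n = 0"
    by blast
  then have "ev (monom 1 n - q) = 0"
    by (simp add: ev_diff)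
  moreover have "monom 1 n - q \<noteq> 0"
  proof
    assume "monom 1 n - q = 0"
    then have "coeff (monom 1 n - q) n = 0" by simp
    with q show False by simp
  qed
  ultimately obtain p where p: "p \<noteq> 0" "ev p = 0"
    and min: "\<And>q. q \<noteq> 0 \<Longrightarrow> ev q = 0 \<Longrightarrow> degree p \<le> degree q"
    using ex_has_least_nat[of "\<lambda>p. p \<noteq> 0 \<and> ev p = 0" _ degree] by blast
  have "degree p \<noteq> 0"
  proof
    assume "degree p = 0"
    then obtain a where "p = [:a:]"
      by (rule degree_eq_zeroE)
    with p v show False by simp
  qed
  then obtain z where "poly p z = 0"
    using alg_closed_imp_poly_has_root[of p] by blast
  then obtain q where q: "p = [:- z, 1:] * q"
    by (metis dvd_def poly_eq_0_iff_dvd)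
  with p have "q \<noteq> 0" by auto
  with q have "degree q < degree p"
    using degree_mult_eq[of "[:- z, 1:]" q] by (simp del: mult_pCons_left)
  with min \<open>q \<noteq> 0\<close> have "ev q \<noteq> 0"
    using leD by blast
  moreover have "T (ev q) = scale z (ev q)"
  proof -
    have "p = smult (- z) q + pCons 0 q"
      using q by simp
    then show ?thesis
      using p(2) by (simp only: ev_add ev_smult ev_pCons) (simp add: algebra_simps)
  qed
  ultimately show thesis
    using that ev_in_U by blast
qed

lemma (in vector_space) separating_functional:
  assumes U: "subspace U" and y: "y \<notin> U"
  obtains f where "Vector_Spaces.linear scale (*) f" "\<And>u. u \<in> U \<Longrightarrow> f u = 0" "f y = 1"
proof -
  interpret vector_space_pair scale "(*)"
    by (intro vector_space_pair.intro vector_space_axioms vector_space.intro)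
      (simp_all add: distrib_left distrib_right mult.assoc)
  obtain C where C: "C \<subseteq> U" "independent C" "U \<subseteq> span C"
    using basis_exists[of U] by metis
  with U have "span C = U"
    by (simp add: span_minimal subset_antisym)
  with y C have "independent (insert y C)" "y \<notin> C"
    using independent_insertI by auto
  from linear_independent_extend[OF this(1), of "\<lambda>x. if x = y then 1 else 0"]
  obtain f where f: "Vector_Spaces.linear scale (*) f" "\<forall>x\<in>insert y C. f x = (if x = y then 1 else 0)"
    by metis
  interpret f: Vector_Spaces.linear scale "(*)" f by (rule f(1))
  show thesis
  proof
    fix u assume "u \<in> U"
    then have "u \<in> span C"
      using \<open>span C = U\<close> by simp
    moreover have "f x = 0" if "x \<in> C" for x
    proof -
      have "x \<noteq> y" using that \<open>y \<notin> C\<close> by blast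
      with f(2) that show ?thesis by simp
    qed
    ultimately show "f u = 0"
      using f.eq_0_on_span by blast
  next
    show "f y = 1" using f(2) by simp
  qed (rule f(1))
qed

section \<open>Minimal idempotents of a semisimple algebra\<close>

definition minimal_idempotent ::
  "('k::field \<Rightarrow> 'a::{ring, monoid_mult} \<Rightarrow> 'a) \<Rightarrow> 'a \<Rightarrow> bool" where
  "minimal_idempotent scale e \<longleftrightarrow> e * e = e \<and> simple_left_ideal scale (range (\<lambda>a. a * e))"

text \<open>For idempotents \<open>f\<close> and \<open>e\<close> this is \<open>f A e\<close>.\<close>

definition peirce_component :: "'a::{ring, monoid_mult} \<Rightarrow> 'a \<Rightarrow> 'a set" where
  "peirce_component f e = {g. f * g = g \<and> g * e = g}"

context assoc_algebra
begin

lemma linear_mult_right: "Vector_Spaces.linear scale scale (\<lambda>x. x * r)"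
  unfolding Vector_Spaces.linear_iff using vector_space_axioms by (simp add: scale_mult_left distrib_right)

lemma minimal_idempotent_idem: "minimal_idempotent scale e \<Longrightarrow> e * e = e"
  by (simp add: minimal_idempotent_def)

lemma minimal_idempotent_left_ideal:
  assumes "minimal_idempotent scale e" "left_ideal scale L" "L \<subseteq> range (\<lambda>a. a * e)" "x \<in> L" "x \<noteq> 0"
  shows "L = range (\<lambda>a. a * e)"
  using assms unfolding minimal_idempotent_def simple_left_ideal_def by blast

lemma left_ideal_range_mult: "left_ideal scale (range (\<lambda>a. a * g))"
  unfolding left_ideal_def
proof (intro conjI allI ballI)
  interpret R: Vector_Spaces.linear scale scale "\<lambda>x. x * g" by (rule linear_mult_right)
  show "subspace (range (\<lambda>a. a * g))"
    by (rule R.subspace_image) simp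
  show "a * x \<in> range (\<lambda>a. a * g)" if "x \<in> range (\<lambda>a. a * g)" for a x
    using that by (auto simp flip: mult.assoc)
qed

lemma left_ideal_annihilator:
  "left_ideal scale {y \<in> range (\<lambda>a. a * e). y * g = 0}"
  using left_ideal_range_mult[of e]
  unfolding left_ideal_def subspace_def
  by (auto simp: distrib_right scale_mult_left mult.assoc)

text \<open>
  The components \<open>u\<^sub>L\<close> of \<open>1\<close> in the decomposition of \<open>A\<close> into simple left ideals \<open>L\<close> are the
  idempotents: for \<open>y \<in> L\<close> the decomposition \<open>y = \<Sum> y u\<^sub>L'\<close> is the trivial one, so \<open>y u\<^sub>L = y\<close>.
  Therefore \<open>u\<^sub>L\<close> is idempotent and \<open>A u\<^sub>L = L\<close>.
\<close>

lemma one_eq_sum_minimal_idempotents: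
  assumes "semisimple_algebra scale"
  obtains F :: "'a set set" and u where "finite F" "\<And>L. L \<in> F \<Longrightarrow> minimal_idempotent scale (u L)" "1 = sum u F"
proof -
  from assms obtain F where F: "finite F" "\<And>L. L \<in> F \<Longrightarrow> simple_left_ideal scale L"
    and dec: "\<And>a. \<exists>!x. x \<in> (\<Pi>\<^sub>E L\<in>F. L) \<and> a = (\<Sum>L\<in>F. x L)"
    unfolding semisimple_algebra_def by blast
  from dec[of 1] obtain u where u: "u \<in> (\<Pi>\<^sub>E L\<in>F. L)" "1 = (\<Sum>L\<in>F. u L)"
    by blast
  have ideal: "0 \<in> L" "\<And>a x. x \<in> L \<Longrightarrow> a * x \<in> L" if "L \<in> F" for L
    using F(2)[OF that] by (auto simp: simple_left_ideal_def left_ideal_def subspace_0)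
  have fix_y: "y * u L = y" if L: "L \<in> F" and y: "y \<in> L" for L y
  proof -
    \<comment> \<open>\<open>y\<close> and \<open>y * 1\<close> are two decompositions of the same element.\<close>
    define p where "p L' = (if L' \<in> F then y * u L' else undefined)" for L'
    define q where "q L' = (if L' \<in> F then if L' = L then y else 0 else undefined)" for L'
    have "p \<in> (\<Pi>\<^sub>E L\<in>F. L)"
      using u(1) ideal by (auto simp: p_def PiE_iff extensional_def)
    moreover have "y = (\<Sum>L\<in>F. p L)"
      using arg_cong[OF u(2), of "\<lambda>z. y * z"] by (simp add: p_def sum_distrib_left)
    moreover have "q \<in> (\<Pi>\<^sub>E L\<in>F. L)"
      using y ideal by (auto simp: q_def PiE_iff extensional_def)
    moreover have "y = (\<Sum>L\<in>F. q L)"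
      using F(1) L by (simp add: q_def)
    ultimately have "p = q"
      using dec[of y] by blast
    then have "p L = q L" by simp
    with L show ?thesis by (simp add: p_def q_def)
  qed
  have "minimal_idempotent scale (u L)" if L: "L \<in> F" for L
  proof -
    have uL: "u L \<in> L"
      using u(1) L by auto
    have "range (\<lambda>a. a * u L) = L"
      using fix_y[OF L] ideal(2)[OF L uL] by (metis image_subset_iff rangeI subsetI subset_antisym)
    then show ?thesis
      using F(2)[OF L] fix_y[OF L uL] by (simp add: minimal_idempotent_def)
  qed
  from F(1) this u(2) show thesis
    by (rule that)
qed

text \<open>
  First half of Schur's lemma, with \<open>f A e\<close> in the role of the homomorphisms from \<open>A f\<close> to \<open>A e\<close>:
  right multiplication by \<open>g\<close> has image \<open>A g = A e\<close> and a kernel that is a proper left subideal of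
  \<open>A f\<close>, hence zero.
\<close>

lemma peirce_component_invertible:
  assumes e: "minimal_idempotent scale e" and f: "minimal_idempotent scale f"
    and g: "g \<in> peirce_component f e" "g \<noteq> 0"
  obtains c where "c \<in> peirce_component e f" "c * g = e" "g * c = f"
    and "\<And>y. y \<in> range (\<lambda>a. a * f) \<Longrightarrow> y * g = 0 \<Longrightarrow> y = 0"
proof -
  have fg: "f * g = g" and ge: "g * e = g"
    using g by (auto simp: peirce_component_def)
  have ee: "e * e = e" and ff: "f * f = f"
    using e f by (auto simp: minimal_idempotent_idem)
  have "range (\<lambda>a. a * g) \<subseteq> range (\<lambda>a. a * e)"
    using ge by (metis image_subsetI mult.assoc rangeI)
  moreover have "g \<in> range (\<lambda>a. a * g)"
    by (metis mult_1 rangeI)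
  ultimately have "range (\<lambda>a. a * g) = range (\<lambda>a. a * e)"
    using minimal_idempotent_left_ideal[OF e left_ideal_range_mult] g(2) by blast
  moreover have "e \<in> range (\<lambda>a. a * e)"
    by (metis mult_1 rangeI)
  ultimately obtain c0 where c0: "e = c0 * g"
    by blast
  have inj: "y = 0" if y: "y \<in> range (\<lambda>a. a * f)" "y * g = 0" for y
  proof (rule ccontr)
    assume "y \<noteq> 0"
    moreover have "y \<in> {y \<in> range (\<lambda>a. a * f). y * g = 0}"
      using y by blast
    ultimately have "{y \<in> range (\<lambda>a. a * f). y * g = 0} = range (\<lambda>a. a * f)"
      by (intro minimal_idempotent_left_ideal[OF f left_ideal_annihilator]) auto
    moreover have "f \<in> range (\<lambda>a. a * f)"
      by (metis mult_1 rangeI)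
    ultimately have "f * g = 0" by blast
    with fg g(2) show False by simp
  qed
  define c where "c = e * c0 * f"
  have cg: "c * g = e"
    using c0 fg ee by (simp add: c_def mult.assoc)
  have "c \<in> peirce_component e f"
    using ee ff by (simp add: c_def peirce_component_def mult.assoc flip: mult.assoc[of e e])
  moreover have "g * c = f"
  proof -
    \<comment> \<open>The difference lies in \<open>A f\<close> and is annihilated by \<open>g\<close>.\<close>
    have "g * c - f = (g * e * c0 - 1) * f"
      by (simp add: c_def algebra_simps)
    moreover have "(g * c - f) * g = 0"
      using cg fg ge by (simp add: left_diff_distrib mult.assoc)
    ultimately show ?thesis
      using inj[of "g * c - f"] by (metis rangeI eq_iff_diff_eq_0)
  qed
  ultimately show thesis
    using that cg inj by blast
qed

end

text \<open>
  Second half of Schur's lemma. If \<open>g \<noteq> 0\<close> has inverse \<open>c\<close>, then right multiplication by \<open>h c\<close> is an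
  endomorphism of \<open>A f\<close>; for an eigenvector \<open>w\<close> with eigenvalue \<open>z\<close> one gets \<open>w (h - z g) = 0\<close>, so
  \<open>h - z g\<close> is not invertible and therefore zero. The generator \<open>g\<close> is \<open>0\<close> when \<open>f A e = 0\<close>.
\<close>

lemma peirce_component_cyclic:
  fixes scale :: "'k::alg_closed_field \<Rightarrow> 'a::{ring, monoid_mult} \<Rightarrow> 'a"
  assumes "assoc_algebra scale" and fd: "finite_dim scale"
    and e: "minimal_idempotent scale e" and f: "minimal_idempotent scale f"
  obtains g where "g \<in> peirce_component f e"
    and "\<And>h. h \<in> peirce_component f e \<Longrightarrow> \<exists>c. h = scale c g"
proof (cases "peirce_component f e \<subseteq> {0}")
  case True
  interpret assoc_algebra scale by fact
  have "0 \<in> peirce_component f e"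
    by (simp add: peirce_component_def)
  moreover have "\<exists>c. h = scale c 0" if "h \<in> peirce_component f e" for h
    using True that by auto
  ultimately show thesis
    using that by blast
next
  case False
  interpret assoc_algebra scale by fact
  from False obtain g where g: "g \<in> peirce_component f e" "g \<noteq> 0"
    by blast
  then obtain c where c: "c \<in> peirce_component e f" "c * g = e" "g * c = f"
    and inj: "\<And>y. y \<in> range (\<lambda>a. a * f) \<Longrightarrow> y * g = 0 \<Longrightarrow> y = 0"
    using peirce_component_invertible[OF e f] by blast
  have "\<exists>z. h = scale z g" if h: "h \<in> peirce_component f e" for h
  proof -
    have fh: "f * h = h" and he: "h * e = h" and cf: "c * f = c" and fg: "f * g = g"
      using h c(1) g(1) by (auto simp: peirce_component_def)
    have f_in: "f \<in> range (\<lambda>a. a * f)"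
      by (metis mult_1 rangeI)
    have f0: "f \<noteq> 0"
      using fg g(2) by auto
    have inv: "y * (h * c) \<in> range (\<lambda>a. a * f)" for y
      by (metis cf mult.assoc rangeI)
    have sub: "subspace (range (\<lambda>a. a * f))"
      using left_ideal_range_mult left_ideal_def by blast
    obtain w z where w: "w \<in> range (\<lambda>a. a * f)" "w \<noteq> 0" "w * (h * c) = scale z w"
      using eigenvector_in_invariant_subspace[OF fd linear_mult_right sub inv f_in f0] by blast
    have "w * (h - scale z g) = w * (h * (c * g)) - scale z w * g"
      using c(2) he by (simp add: right_diff_distrib scale_mult_right scale_mult_left)
    also have "\<dots> = 0"
      by (metis mult.assoc w(3) diff_self)
    finally have wz: "w * (h - scale z g) = 0" .
    show ?thesis
    proof (rule ccontr)
      assume "\<not> ?thesis"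
      then have "h - scale z g \<noteq> 0" by auto
      moreover have "h - scale z g \<in> peirce_component f e"
        using h g(1) by (simp add: peirce_component_def algebra_simps scale_mult_right scale_mult_left)
      ultimately show False
        using peirce_component_invertible[OF e f] wz w(1,2) by metis
    qed
  qed
  with g(1) that show thesis by blast
qed

section \<open>Bimodules\<close>

context bimodule
begin

abbreviation "sub \<equiv> sub_bimodule scaleM lact ract"

lemma lact_scaleA: "lact (scaleA c a) x = scaleM c (lact a x)"
  by (metis lact_mult lact_scalar mult_1 scale_mult_left)

lemma ract_scaleA: "ract x (scaleA c a) = scaleM c (ract x a)"
  by (metis ract_mult ract_scalar mult_1_right scale_mult_right)

lemma lact_scaleM: "lact a (scaleM c x) = scaleM c (lact a x)"
  by (metis lact_mult lact_scaleA lact_scalar mult_1_right scale_mult_right)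

lemma ract_scaleM: "ract (scaleM c x) a = scaleM c (ract x a)"
  by (metis ract_mult ract_scaleA ract_scalar mult_1_left scale_mult_left)

lemma linear_lact: "Vector_Spaces.linear scaleM scaleM (lact a)"
  unfolding Vector_Spaces.linear_iff
  using M.vector_space_axioms by (simp add: lact_add_right lact_scaleM)

lemma linear_ract: "Vector_Spaces.linear scaleM scaleM (\<lambda>x. ract x a)"
  unfolding Vector_Spaces.linear_iff
  using M.vector_space_axioms by (simp add: ract_add_left ract_scaleM)

lemma lact_zero_left [simp]: "lact 0 x = 0"
  using lact_add_left[of 0 0 x] by simp

lemma ract_zero_right [simp]: "ract x 0 = 0"
  using ract_add_right[of x 0 0] by simp

lemma lact_zero_right [simp]: "lact a 0 = 0"
  using lact_add_right[of a 0 0] by simp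

lemma ract_zero_left [simp]: "ract 0 a = 0"
  using ract_add_left[of 0 0 a] by simp

lemma lact_sum_left: "lact (sum u F) x = (\<Sum>i\<in>F. lact (u i) x)"
  by (induction F rule: infinite_finite_induct) (simp_all add: lact_add_left)

lemma lact_sum_right: "lact a (sum y F) = (\<Sum>i\<in>F. lact a (y i))"
  by (induction F rule: infinite_finite_induct) (simp_all add: lact_add_right)

lemma ract_sum_right: "ract x (sum u F) = (\<Sum>i\<in>F. ract x (u i))"
  by (induction F rule: infinite_finite_induct) (simp_all add: ract_add_right)

lemma subD:
  assumes "sub S"
  shows "M.subspace S" "0 \<in> S" "x \<in> S \<Longrightarrow> y \<in> S \<Longrightarrow> x + y \<in> S" "x \<in> S \<Longrightarrow> y \<in> S \<Longrightarrow> x - y \<in> S"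
    "x \<in> S \<Longrightarrow> scaleM c x \<in> S" "x \<in> S \<Longrightarrow> lact a x \<in> S" "x \<in> S \<Longrightarrow> ract x a \<in> S"
  using assms
  by (simp_all add: sub_bimodule_def M.subspace_0 M.subspace_add M.subspace_diff M.subspace_scale)

lemma sub_zero: "sub {0}"
  by (simp add: sub_bimodule_def)

lemma sub_plus:
  assumes S: "sub S" and T: "sub T"
  shows "sub {s + t |s t. s \<in> S \<and> t \<in> T}"
proof -
  have "lact a x \<in> {s + t |s t. s \<in> S \<and> t \<in> T} \<and> ract x a \<in> {s + t |s t. s \<in> S \<and> t \<in> T}"
    if "x \<in> {s + t |s t. s \<in> S \<and> t \<in> T}" for a x
  proof -
    from that obtain s t where "x = s + t" "s \<in> S" "t \<in> T" by blast
    then have "lact a x = lact a s + lact a t" "ract x a = ract s a + ract t a"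
      and "lact a s \<in> S" "lact a t \<in> T" "ract s a \<in> S" "ract t a \<in> T"
      using subD(6,7)[OF S] subD(6,7)[OF T] by (simp_all add: lact_add_right ract_add_left)
    then show ?thesis by blast
  qed
  then show ?thesis
    using M.subspace_sums[OF subD(1)[OF S] subD(1)[OF T]] by (simp add: sub_bimodule_def)
qed

text \<open>The sub-bimodule \<open>A x A\<close>.\<close>

definition generated :: "'m \<Rightarrow> 'm set" where
  "generated x = M.span {lact a (ract x b) |a b. True}"

lemma generator_mem: "lact a (ract x b) \<in> generated x"
  unfolding generated_def by (rule M.span_base) blast

lemma generator_self: "x \<in> generated x"
  using generator_mem[of 1 x 1] by (simp add: lact_one ract_one)

lemma sub_generated: "sub (generated x)"
proof -
  have L: "lact c ` generated x \<subseteq> generated x" for c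
  proof -
    interpret L: Vector_Spaces.linear scaleM scaleM "lact c" by (rule linear_lact)
    have "lact c ` {lact a (ract x b) |a b. True} \<subseteq> {lact a (ract x b) |a b. True}"
      unfolding image_subset_iff by (auto simp flip: lact_mult) blast
    then show ?thesis
      unfolding generated_def L.span_image[symmetric] by (rule M.span_mono)
  qed
  have R: "(\<lambda>y. ract y c) ` generated x \<subseteq> generated x" for c
  proof -
    interpret R: Vector_Spaces.linear scaleM scaleM "\<lambda>y. ract y c" by (rule linear_ract)
    have "(\<lambda>y. ract y c) ` {lact a (ract x b) |a b. True} \<subseteq> {lact a (ract x b) |a b. True}"
      unfolding image_subset_iff by (auto simp flip: lact_ract ract_mult) blast
    then show ?thesis
      unfolding generated_def R.span_image[symmetric] by (rule M.span_mono)
  qed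
  show ?thesis
    using L R M.subspace_span unfolding sub_bimodule_def image_subset_iff
    by (simp add: generated_def)
qed

lemma generated_minimal:
  assumes "sub Q" "x \<in> Q"
  shows "generated x \<subseteq> Q"
  unfolding generated_def
  by (rule M.span_minimal) (use subD[OF assms(1)] assms(2) in auto)

text \<open>
  Since \<open>1\<close> acts as the identity on both sides, \<open>x\<close> is the sum of the elements \<open>u\<^sub>i x u\<^sub>j\<close>, which
  cannot all lie in \<open>Q\<close>.
\<close>

lemma peirce_part_not_in_sub:
  assumes "1 = sum u F" and Q: "sub Q" and x: "x \<notin> Q"
  obtains i j where "i \<in> F" "j \<in> F" "lact (u i) (ract x (u j)) \<notin> Q"
proof -
  have "x = lact (sum u F) (ract x (sum u F))"
    using assms(1) by (metis lact_one ract_one)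
  also have "\<dots> = (\<Sum>i\<in>F. \<Sum>j\<in>F. lact (u i) (ract x (u j)))"
    by (simp add: lact_sum_left ract_sum_right lact_sum_right) (rule sum.swap)
  finally have sum: "x = (\<Sum>i\<in>F. \<Sum>j\<in>F. lact (u i) (ract x (u j)))" .
  show thesis
  proof (rule ccontr)
    assume "\<not> thesis"
    with that have "lact (u i) (ract x (u j)) \<in> Q" if "i \<in> F" "j \<in> F" for i j
      using \<open>i \<in> F\<close> \<open>j \<in> F\<close> by blast
    then have "(\<Sum>i\<in>F. \<Sum>j\<in>F. lact (u i) (ract x (u j))) \<in> Q"
      by (intro M.subspace_sum subD(1)[OF Q])
    with x sum show False by simp
  qed
qed

end

section \<open>Symplectic bimodules\<close>

locale symplectic_bimodule = bimodule scaleA scaleM lact ract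
  for scaleA :: "'k::field \<Rightarrow> 'a::{ring, monoid_mult} \<Rightarrow> 'a"
    and scaleM :: "'k \<Rightarrow> 'm::ab_group_add \<Rightarrow> 'm"
    and lact :: "'a \<Rightarrow> 'm \<Rightarrow> 'm" and ract :: "'m \<Rightarrow> 'a \<Rightarrow> 'm" +
  fixes \<omega> :: "'m \<Rightarrow> 'm \<Rightarrow> 'k"
  assumes symplectic: "symplectic_form scaleM \<omega>"
    and bal: "balanced lact ract \<omega>"
begin

lemma form_linear_right: "Vector_Spaces.linear scaleM (*) (\<omega> x)"
  using symplectic by (simp add: symplectic_form_def)

lemma form_linear_left: "Vector_Spaces.linear scaleM (*) (\<lambda>x. \<omega> x y)"
  using symplectic by (simp add: symplectic_form_def)

lemma form_bilinear [simp]: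
  "\<omega> (x + x') y = \<omega> x y + \<omega> x' y" "\<omega> x (y + y') = \<omega> x y + \<omega> x y'"
  "\<omega> (scaleM c x) y = c * \<omega> x y" "\<omega> x (scaleM c y) = c * \<omega> x y"
  using form_linear_left form_linear_right by (auto simp: Vector_Spaces.linear_iff)

lemma form_zero [simp]: "\<omega> 0 y = 0" "\<omega> x 0 = 0"
  using form_bilinear(3)[of 0 0 y] form_bilinear(4)[of x 0 0] by simp_all

lemma form_diff: "\<omega> (x - x') y = \<omega> x y - \<omega> x' y"
  using form_bilinear(1)[of "x - x'" x' y] by simp

lemma form_self [simp]: "\<omega> x x = 0"
  using symplectic by (simp add: symplectic_form_def)

lemma form_swap: "\<omega> y x = - \<omega> x y"
proof -
  have "\<omega> x y + \<omega> y x = \<omega> (x + y) (x + y)"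
    using form_self[of x] form_self[of y] by (simp only: form_bilinear) simp
  also have "\<dots> = 0" by (rule form_self)
  finally show ?thesis by (simp add: eq_neg_iff_add_eq_0 add.commute)
qed

lemma form_nondegenerate: "(\<And>y. \<omega> x y = 0) \<Longrightarrow> x = 0"
  using symplectic by (simp add: symplectic_form_def)

lemma form_lact_right: "\<omega> x (lact a y) = \<omega> (ract x a) y"
  using bal by (simp add: balanced_def)

text \<open>
  Balancedness moves \<open>A\<close> across the inner sides; because \<open>\<omega>\<close> is antisymmetric, it moves \<open>A\<close> across
  the outer sides as well.
\<close>

lemma form_lact_left: "\<omega> (lact a x) y = \<omega> x (ract y a)"
  by (metis form_lact_right form_swap)

lemma form_peirce: "\<omega> (lact e (ract x f)) y = \<omega> x (lact f (ract y e))"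
  by (simp add: form_lact_left form_lact_right)

lemma mem_perp: "m \<in> perp \<omega> U \<longleftrightarrow> (\<forall>u\<in>U. \<omega> m u = 0)"
  by (simp add: perp_def)

lemma isotropic_iff: "isotropic \<omega> U \<longleftrightarrow> (\<forall>u\<in>U. \<forall>v\<in>U. \<omega> u v = 0)"
  by (auto simp: isotropic_def perp_def)

lemma sub_perp:
  assumes "sub U"
  shows "sub (perp \<omega> U)"
  unfolding sub_bimodule_def
proof (intro conjI allI ballI)
  show "M.subspace (perp \<omega> U)"
    by (rule M.subspaceI) (simp_all add: mem_perp)
  show "lact a x \<in> perp \<omega> U" if "x \<in> perp \<omega> U" for a x
    using that subD(7)[OF assms] by (simp add: mem_perp form_lact_left)
  show "ract x a \<in> perp \<omega> U" if "x \<in> perp \<omega> U" for a x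
    using that subD(6)[OF assms] by (simp add: mem_perp flip: form_lact_right)
qed

lemma isotropic_plus:
  assumes "isotropic \<omega> U" "isotropic \<omega> P" "P \<subseteq> perp \<omega> U"
  shows "isotropic \<omega> {u + p |u p. u \<in> U \<and> p \<in> P}"
proof -
  have "\<omega> p u = 0" "\<omega> u p = 0" if "u \<in> U" "p \<in> P" for u p
    using that assms(3) form_swap[of u p] by (auto simp: perp_def)
  with assms(1,2) show ?thesis
    by (auto simp: isotropic_iff)
qed

text \<open>
  By balancedness, orthogonality to a sub-bimodule passes from \<open>x\<close> to \<open>A x A\<close>; so it suffices to
  test the generator.
\<close>

lemma isotropic_generated:
  assumes orth: "\<And>a b. \<omega> x (lact a (ract x b)) = 0"
  shows "isotropic \<omega> (generated x)"
proof -
  have "generated x \<subseteq> perp \<omega> (generated x)"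
  proof (rule generated_minimal[OF sub_perp[OF sub_generated]])
    have "\<forall>z\<in>generated x. \<omega> z x = 0"
    proof -
      have "generated x \<subseteq> {z. \<omega> z x = 0}"
        unfolding generated_def
      proof (rule M.span_minimal)
        show "M.subspace {z. \<omega> z x = 0}"
          by (rule M.subspaceI) simp_all
        show "{lact a (ract x b) |a b. True} \<subseteq> {z. \<omega> z x = 0}"
        proof safe
          fix a b
          show "\<omega> (lact a (ract x b)) x = 0"
            using orth[of a b] form_swap[of x "lact a (ract x b)"] by simp
        qed
      qed
      then show ?thesis by blast
    qed
    then show "x \<in> perp \<omega> (generated x)"
      using form_swap[of _ x] by (simp add: mem_perp)
  qed
  then show ?thesis by (simp add: isotropic_def)
qed

text \<open>
  Non-degeneracy makes the endomorphism \<open>m \<mapsto> \<Sum>b\<in>B. \<omega>(m, b) b\<close> of \<open>M\<close> injective, where \<open>B\<close> is a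
  basis. In finite dimension it is then surjective, so the values \<open>\<omega>(m, b)\<close> can be prescribed on
  the basis.
\<close>

lemma representing_vector:
  assumes fd: "finite_dim scaleM" and f: "Vector_Spaces.linear scaleM (*) f"
  obtains m where "\<And>x. \<omega> m x = f x"
proof -
  from fd obtain B where "finite_dimensional_vector_space scaleM B"
    by (auto simp: finite_dim_def)
  then interpret V: finite_dimensional_vector_space scaleM B .
  define \<theta> where "\<theta> m = (\<Sum>b\<in>B. scaleM (\<omega> m b) b)" for m
  have coord: "\<forall>b\<in>B. c b = d b" if "(\<Sum>b\<in>B. scaleM (c b) b) = (\<Sum>b\<in>B. scaleM (d b) b)" for c d
  proof -
    have "(\<Sum>b\<in>B. scaleM (c b - d b) b) = 0"
      using that by (simp add: M.scale_left_diff_distrib sum_subtractf)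
    then show ?thesis
      using M.independentD[OF V.independent_Basis V.finite_Basis subset_refl, of "\<lambda>b. c b - d b"]
      by auto
  qed
  have eq_on_B: "g = h" if g: "Vector_Spaces.linear scaleM (*) g" and h: "Vector_Spaces.linear scaleM (*) h"
    and "\<And>b. b \<in> B \<Longrightarrow> g b = h b" for g h
  proof
    fix x
    interpret vector_space_pair scaleM "(*) :: 'k \<Rightarrow> 'k \<Rightarrow> 'k"
      using g by (simp add: Vector_Spaces.linear_iff vector_space_pair_def)
    show "g x = h x"
      by (rule linear_eq_on[OF g h, of x B]) (simp_all add: V.span_Basis that(3))
  qed
  have lin: "Vector_Spaces.linear scaleM scaleM \<theta>"
    unfolding Vector_Spaces.linear_iff \<theta>_def using M.vector_space_axioms
    by (simp add: M.scale_left_distrib sum.distrib M.scale_sum_right)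
  have "inj \<theta>"
  proof (rule injI)
    fix m m' assume "\<theta> m = \<theta> m'"
    then have "\<omega> m = \<omega> m'"
      using coord unfolding \<theta>_def by (intro eq_on_B form_linear_right) blast
    then have "m - m' = 0"
      by (intro form_nondegenerate) (simp add: form_diff)
    then show "m = m'" by simp
  qed
  with lin have "surj \<theta>"
    by (rule V.linear_inj_imp_surj)
  then obtain m where "(\<Sum>b\<in>B. scaleM (f b) b) = \<theta> m"
    by (rule surjE)
  then have "\<omega> m = f"
    using coord unfolding \<theta>_def by (intro eq_on_B form_linear_right f) metis
  with that show thesis by blast
qed

text \<open>
  A vector outside \<open>U\<close> is detected by a functional that vanishes on \<open>U\<close>; the vector that represents
  this functional lies in \<open>U\<^sup>\<bottom>\<close>.
\<close>

lemma perp_perp_subset: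
  assumes fd: "finite_dim scaleM" and U: "M.subspace U"
  shows "perp \<omega> (perp \<omega> U) \<subseteq> U"
proof
  fix y assume y: "y \<in> perp \<omega> (perp \<omega> U)"
  show "y \<in> U"
  proof (rule ccontr)
    assume "y \<notin> U"
    then obtain f where f: "Vector_Spaces.linear scaleM (*) f" "\<And>u. u \<in> U \<Longrightarrow> f u = 0" "f y = 1"
      using M.separating_functional[OF U] by blast
    then obtain m where m: "\<And>x. \<omega> m x = f x"
      using representing_vector[OF fd] by blast
    with f(2) have "m \<in> perp \<omega> U"
      by (simp add: mem_perp)
    with y have "\<omega> m y = 0"
      using form_swap[of m y] by (simp add: mem_perp)
    with m f(3) show False by simp
  qed
qed

text \<open>
  If \<open>x = s + d\<close> is orthogonal to \<open>D\<close>, then so is \<open>s\<close>; being in \<open>S\<close>, it is orthogonal to \<open>S\<close> as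
  well, hence to all of \<open>M\<close>, and \<open>s = 0\<close>.
\<close>

lemma lagrangian_complement:
  assumes S: "lagrangian \<omega> S" and D: "isotropic \<omega> D" "internal_direct_sum S D"
  shows "lagrangian \<omega> D"
  unfolding lagrangian_def
proof
  show "D \<subseteq> perp \<omega> D"
    using D(1) by (simp add: isotropic_def)
  have decomp: "\<exists>s\<in>S. \<exists>d\<in>D. x = s + d" for x
    using D(2) unfolding internal_direct_sum_def by blast
  show "perp \<omega> D \<subseteq> D"
  proof
    fix x assume x: "x \<in> perp \<omega> D"
    obtain s d where sd: "s \<in> S" "d \<in> D" "x = s + d"
      using decomp by blast
    have sD: "\<omega> s d' = 0" if "d' \<in> D" for d'
      using that x sd D(1) unfolding isotropic_iff mem_perp by (metis add_0_right form_bilinear(1))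
    have sS: "\<omega> s s' = 0" if "s' \<in> S" for s'
      using that sd(1) S unfolding lagrangian_def by (metis mem_perp)
    have "s = 0"
    proof (rule form_nondegenerate)
      fix y
      obtain s' d' where "s' \<in> S" "d' \<in> D" "y = s' + d'"
        using decomp by blast
      with sD sS show "\<omega> s y = 0" by simp
    qed
    with sd show "x \<in> D" by simp
  qed
qed

text \<open>
  The map is \<open>x \<mapsto> (p x, \<omega>(x, \<cdot>)|S)\<close> with \<open>p\<close> the projection to \<open>S\<close> along \<open>D\<close>. It respects the
  actions because \<open>p\<close> does and \<open>\<omega>\<close> is balanced. An element of the kernel lies in
  \<open>D \<inter> S\<^sup>\<bottom> = D \<inter> S = 0\<close>. A functional \<open>f\<close> on \<open>S\<close> extends to \<open>f \<circ> p\<close> on \<open>M\<close>, and if \<open>m\<close>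
  represents this extension, then the \<open>D\<close>-part of \<open>m\<close> represents \<open>f\<close>, since the \<open>S\<close>-part is
  orthogonal to \<open>S\<close>.
\<close>

lemma iso_sum_dual_of_complement:
  assumes fd: "finite_dim scaleM" and S: "sub S" "lagrangian \<omega> S"
    and D: "sub D" "isotropic \<omega> D" "internal_direct_sum S D"
  obtains \<phi> where "iso_sum_dual scaleM lact ract S \<phi>"
    and "\<And>x x'. case (\<phi> x, \<phi> x') of ((s, f), (s', f')) \<Rightarrow> \<omega> x x' = f s' - f' s"
proof -
  have unique: "s = s' \<and> d = d'" if "s \<in> S" "s' \<in> S" "d \<in> D" "d' \<in> D" "s + d = s' + d'" for s s' d d'
  proof -
    have "s - s' = d' - d"
      using that(5) by (simp add: algebra_simps)
    moreover have "s - s' \<in> S" "d' - d \<in> D"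
      using that subD(4)[OF S(1)] subD(4)[OF D(1)] by auto
    ultimately have "s - s' \<in> S \<inter> D" by simp
    then have "s - s' = 0"
      using D(3) unfolding internal_direct_sum_def by blast
    with that(5) show ?thesis by simp
  qed
  define p where "p x = (SOME s. s \<in> S \<and> (\<exists>d\<in>D. x = s + d))" for x
  have "\<exists>s. s \<in> S \<and> (\<exists>d\<in>D. x = s + d)" for x
    using D(3) unfolding internal_direct_sum_def by blast
  then have p: "p x \<in> S" "\<exists>d\<in>D. x = p x + d" for x
    using someI_ex[of "\<lambda>s. s \<in> S \<and> (\<exists>d\<in>D. x = s + d)"] unfolding p_def by auto
  have pI: "p (s + d) = s" if "s \<in> S" "d \<in> D" for s d
    using p[of "s + d"] that unique by metis
  define r where "r x = x - p x" for x
  have r: "r x \<in> D" "x = p x + r x" for x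
    using p(2)[of x] unfolding r_def by (metis add_diff_cancel_left')+
  have p_add: "p (x + y) = p x + p y" for x y
  proof -
    have "x + y = (p x + p y) + (r x + r y)"
      by (simp add: r_def)
    then show ?thesis
      using pI[of "p x + p y" "r x + r y"] r(1) p(1) subD(3)[OF S(1)] subD(3)[OF D(1)] by simp
  qed
  have p_scale: "p (scaleM c x) = scaleM c (p x)" for c x
    using pI[of "scaleM c (p x)" "scaleM c (r x)"] r p(1) subD(5)[OF S(1)] subD(5)[OF D(1)]
    by (simp flip: M.scale_right_distrib)
  have p_lact: "p (lact a x) = lact a (p x)" for a x
    using pI[of "lact a (p x)" "lact a (r x)"] r p(1) subD(6)[OF S(1)] subD(6)[OF D(1)]
    by (simp flip: lact_add_right)
  have p_ract: "p (ract x a) = ract (p x) a" for a x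
    using pI[of "ract (p x) a" "ract (r x) a"] r p(1) subD(7)[OF S(1)] subD(7)[OF D(1)]
    by (simp flip: ract_add_left)
  define q where "q x = (\<lambda>t. if t \<in> S then \<omega> x t else 0)" for x
  define \<phi> where "\<phi> x = (p x, q x)" for x
  have SS: "\<omega> s t = 0" if "s \<in> S" "t \<in> S" for s t
    using that S(2) unfolding lagrangian_def by (metis mem_perp)
  have DD: "\<omega> d t = 0" if "d \<in> D" "t \<in> D" for d t
    using that D(2) by (simp add: isotropic_iff)
  have "inj \<phi>"
  proof (rule injI)
    fix x y assume eq: "\<phi> x = \<phi> y"
    then have "\<omega> x t = \<omega> y t" if "t \<in> S" for t
      using that by (simp add: \<phi>_def q_def fun_eq_iff) metis
    then have "x - y \<in> perp \<omega> S"
      by (simp add: mem_perp form_diff)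
    then have "x - y \<in> S"
      using S(2) by (simp add: lagrangian_def)
    moreover have "x - y = r x - r y"
      using eq by (simp add: \<phi>_def r_def)
    ultimately have "x - y \<in> S \<inter> D"
      using subD(4)[OF D(1) r(1) r(1)] by simp
    then have "x - y = 0"
      using D(3) unfolding internal_direct_sum_def by blast
    then show "x = y" by simp
  qed
  moreover have "range \<phi> = S \<times> dual_space scaleM S"
  proof
    show "range \<phi> \<subseteq> S \<times> dual_space scaleM S"
      using p(1) subD(3,5)[OF S(1)] by (auto simp: \<phi>_def q_def dual_space_def)
    show "S \<times> dual_space scaleM S \<subseteq> range \<phi>"
    proof safe
      fix s f assume s: "s \<in> S" and f: "f \<in> dual_space scaleM S"
      have "Vector_Spaces.linear scaleM (*) (\<lambda>x. f (p x))"
        using form_linear_right[of 0] f p(1) unfolding Vector_Spaces.linear_iff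
        by (simp add: p_add p_scale dual_space_def)
      then obtain m where m: "\<And>x. \<omega> m x = f (p x)"
        using representing_vector[OF fd] by blast
      have "q (s + r m) = f"
      proof
        fix t
        show "q (s + r m) t = f t"
        proof (cases "t \<in> S")
          case True
          have "\<omega> (s + r m) t = \<omega> (r m) t"
            using SS s True by simp
          also have "\<dots> = \<omega> (p m + r m) t"
            using SS p(1) True by simp
          also have "\<dots> = f (p t)"
            using m r(2) by metis
          also have "p t = t"
            using pI[of t 0] True subD(2)[OF D(1)] by simp
          finally show ?thesis
            using True by (simp add: q_def)
        next
          case False
          with f show ?thesis by (simp add: q_def dual_space_def)
        qed
      qed
      then have "\<phi> (s + r m) = (s, f)"
        using pI s r(1) by (simp add: \<phi>_def)
      then show "(s, f) \<in> range \<phi>"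
        by (metis rangeI)
    qed
  qed
  ultimately have "bij_betw \<phi> UNIV (S \<times> dual_space scaleM S)"
    by (simp add: bij_betw_def)
  then have "iso_sum_dual scaleM lact ract S \<phi>"
    unfolding iso_sum_dual_def
    using subD(6,7)[OF S(1)]
    by (auto simp: \<phi>_def q_def p_add p_scale p_lact p_ract fun_eq_iff dual_lact_def dual_ract_def
        form_lact_left simp flip: form_lact_right)
  moreover have "case (\<phi> x, \<phi> x') of ((s, f), (s', f')) \<Rightarrow> \<omega> x x' = f s' - f' s" for x x'
  proof -
    have "\<omega> x x' = \<omega> (p x + r x) (p x' + r x')"
      using r(2) by metis
    also have "\<dots> = \<omega> (r x) (p x') - \<omega> (r x') (p x)"
      using form_swap[of "r x'" "p x"] SS[OF p(1) p(1)] DD[OF r(1) r(1)] by simp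
    also have "\<omega> (r x) (p x') = \<omega> x (p x')"
      using SS[OF p(1) p(1), of x x'] by (simp add: r_def form_diff)
    also have "\<omega> (r x') (p x) = \<omega> x' (p x)"
      using SS[OF p(1) p(1), of x' x] by (simp add: r_def form_diff)
    finally show ?thesis
      using p(1) by (simp add: \<phi>_def q_def)
  qed
  ultimately show thesis
    using that by blast
qed

end

section \<open>Maximal isotropic sub-bimodules over semisimple algebras\<close>

locale semisimple_symplectic_bimodule = symplectic_bimodule scaleA scaleM lact ract \<omega>
  for scaleA :: "'k::alg_closed_field \<Rightarrow> 'a::{ring, monoid_mult} \<Rightarrow> 'a"
    and scaleM :: "'k \<Rightarrow> 'm::ab_group_add \<Rightarrow> 'm"
    and lact :: "'a \<Rightarrow> 'm \<Rightarrow> 'm" and ract :: "'m \<Rightarrow> 'a \<Rightarrow> 'm"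
    and \<omega> :: "'m \<Rightarrow> 'm \<Rightarrow> 'k" +
  assumes finite_dim_algebra: "finite_dim scaleA"
    and semisimple: "semisimple_algebra scaleA"
begin

text \<open>
  Both \<open>f a e\<close> and \<open>f b e\<close> are multiples of one element \<open>g\<close>, so \<open>\<omega>(x, a x b)\<close> is a multiple of
  \<open>\<omega>(x, g x g) = \<omega>(x g, x g) = 0\<close>.
\<close>

lemma isotropic_generated_by_peirce_element:
  assumes e: "minimal_idempotent scaleA e" and f: "minimal_idempotent scaleA f"
    and x: "lact e x = x" "ract x f = x"
  shows "isotropic \<omega> (generated x)"
proof (rule isotropic_generated)
  fix a b
  obtain g where g: "\<And>h. h \<in> peirce_component f e \<Longrightarrow> \<exists>c. h = scaleA c g"
    using peirce_component_cyclic[OF assoc_algebra_axioms finite_dim_algebra e f] by blast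
  have peirce: "f * a * e \<in> peirce_component f e" for a
    using minimal_idempotent_idem e f by (simp add: peirce_component_def mult.assoc flip: mult.assoc[of f f])
  obtain c d where c: "f * a * e = scaleA c g" and d: "f * b * e = scaleA d g"
    using g peirce by metis
  have "\<omega> x (lact a (ract x b)) = \<omega> (lact e (ract x f)) (lact a (ract (lact e (ract x f)) b))"
    using x by simp
  also have "\<dots> = \<omega> x (lact f (ract (lact a (ract (lact e (ract x f)) b)) e))"
    by (rule form_peirce)
  also have "\<dots> = \<omega> x (lact (f * a * e) (ract x (f * b * e)))"
    by (simp add: lact_ract ract_mult lact_mult)
  also have "\<dots> = c * d * \<omega> (ract x g) (ract x g)"
    by (simp only: c d lact_scaleA ract_scaleA lact_scaleM form_bilinear form_lact_right) (simp add: mult.assoc)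
  finally show "\<omega> x (lact a (ract x b)) = 0" by simp
qed

text \<open>
  So \<open>A x A\<close> has no proper nonzero sub-bimodule. With minimal idempotents \<open>e'\<close> and \<open>f'\<close> such that
  \<open>e' y f' \<noteq> 0\<close>, and generators \<open>g\<close> of \<open>e' A e\<close> and \<open>h\<close> of \<open>f A f'\<close>, the space \<open>e' (A x A) f'\<close> is
  spanned by \<open>g x h\<close>. Thus \<open>e' y f'\<close> is a nonzero multiple of \<open>g x h\<close>, and cancelling \<open>g\<close> and
  \<open>h\<close> brings \<open>x\<close> into every sub-bimodule that contains \<open>y\<close>.
\<close>

lemma generated_by_peirce_element_simple:
  assumes e: "minimal_idempotent scaleA e" and f: "minimal_idempotent scaleA f"
    and x: "lact e x = x" "ract x f = x"
    and Q: "sub Q" and y: "y \<in> Q" "y \<in> generated x" "y \<noteq> 0"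
  shows "x \<in> Q"
proof -
  obtain F :: "'a set set" and u where u: "\<And>L. L \<in> F \<Longrightarrow> minimal_idempotent scaleA (u L)" "1 = sum u F"
    using one_eq_sum_minimal_idempotents[OF semisimple] by metis
  from y(3) have "y \<notin> {0}" by simp
  then obtain i j where "i \<in> F" "j \<in> F" "lact (u i) (ract y (u j)) \<notin> {0}"
    by (rule peirce_part_not_in_sub[OF u(2) sub_zero])
  then obtain e' f' where e': "minimal_idempotent scaleA e'" and f': "minimal_idempotent scaleA f'"
    and y': "lact e' (ract y f') \<noteq> 0"
    using u(1) by blast
  obtain g where g: "g \<in> peirce_component e' e" "\<And>h. h \<in> peirce_component e' e \<Longrightarrow> \<exists>c. h = scaleA c g"
    using peirce_component_cyclic[OF assoc_algebra_axioms finite_dim_algebra e e'] by blast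
  obtain h where h: "h \<in> peirce_component f f'" "\<And>k. k \<in> peirce_component f f' \<Longrightarrow> \<exists>c. k = scaleA c h"
    using peirce_component_cyclic[OF assoc_algebra_axioms finite_dim_algebra f' f] by blast
  have "generated x \<subseteq> {z. \<exists>c. lact e' (ract z f') = scaleM c (lact g (ract x h))}"
    unfolding generated_def
  proof (rule M.span_minimal)
    show "M.subspace {z. \<exists>c. lact e' (ract z f') = scaleM c (lact g (ract x h))}"
    proof (rule M.subspaceI)
      have "lact e' (ract 0 f') = scaleM 0 (lact g (ract x h))"
        by simp
      then show "0 \<in> {z. \<exists>c. lact e' (ract z f') = scaleM c (lact g (ract x h))}"
        by blast
    next
      fix y z
      assume "y \<in> {z. \<exists>c. lact e' (ract z f') = scaleM c (lact g (ract x h))}"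
        and "z \<in> {z. \<exists>c. lact e' (ract z f') = scaleM c (lact g (ract x h))}"
      then obtain c d where "lact e' (ract y f') = scaleM c (lact g (ract x h))"
        and "lact e' (ract z f') = scaleM d (lact g (ract x h))"
        by blast
      then have "lact e' (ract (y + z) f') = scaleM (c + d) (lact g (ract x h))"
        by (simp add: ract_add_left lact_add_right M.scale_left_distrib)
      then show "y + z \<in> {z. \<exists>c. lact e' (ract z f') = scaleM c (lact g (ract x h))}"
        by blast
    next
      fix d z
      assume "z \<in> {z. \<exists>c. lact e' (ract z f') = scaleM c (lact g (ract x h))}"
      then obtain c where "lact e' (ract z f') = scaleM c (lact g (ract x h))"
        by blast
      then have "lact e' (ract (scaleM d z) f') = scaleM (d * c) (lact g (ract x h))"
        by (simp add: ract_scaleM lact_scaleM)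
      then show "scaleM d z \<in> {z. \<exists>c. lact e' (ract z f') = scaleM c (lact g (ract x h))}"
        by blast
    qed
    show "{lact a (ract x b) |a b. True} \<subseteq> {z. \<exists>c. lact e' (ract z f') = scaleM c (lact g (ract x h))}"
    proof safe
      fix a b
      have "e' * a * e \<in> peirce_component e' e" "f * b * f' \<in> peirce_component f f'"
        using minimal_idempotent_idem e f e' f'
        by (simp_all add: peirce_component_def mult.assoc flip: mult.assoc[of e' e'] mult.assoc[of f f])
      with g(2) h(2) obtain c d where c: "e' * a * e = scaleA c g" and d: "f * b * f' = scaleA d h"
        by metis
      have "lact e' (ract (lact a (ract x b)) f') = lact e' (ract (lact a (ract (lact e (ract x f)) b)) f')"
        using x by simp
      also have "\<dots> = lact (e' * a * e) (ract x (f * b * f'))"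
        by (simp add: lact_ract ract_mult lact_mult)
      also have "\<dots> = scaleM (d * c) (lact g (ract x h))"
        by (simp only: c d lact_scaleA ract_scaleA lact_scaleM M.scale_scale)
      finally show "\<exists>c. lact e' (ract (lact a (ract x b)) f') = scaleM c (lact g (ract x h))"
        by blast
    qed
  qed
  with y(2) obtain c where c: "lact e' (ract y f') = scaleM c (lact g (ract x h))"
    by blast
  with y' have nz: "c \<noteq> 0" "g \<noteq> 0" "h \<noteq> 0"
    by auto
  obtain g' where g': "g' * g = e"
    using peirce_component_invertible[OF e e' g(1) nz(2)] by blast
  obtain h' where h': "h * h' = f"
    using peirce_component_invertible[OF f' f h(1) nz(3)] by blast
  have "x = lact (g' * g) (ract x (h * h'))"
    using x g' h' by simp
  also have "\<dots> = lact g' (ract (lact g (ract x h)) h')"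
    by (simp add: lact_mult ract_mult lact_ract)
  also have "lact g (ract x h) = scaleM (inverse c) (lact e' (ract y f'))"
    using c nz(1) by simp
  finally show ?thesis
    using subD(5-7)[OF Q] y(1) by metis
qed

text \<open>
  Some component \<open>y = u\<^sub>i x u\<^sub>j\<close> of an element \<open>x\<close> of \<open>R\<close> lies outside \<open>Q\<close>. As \<open>A y A\<close> is simple, it
  meets \<open>Q\<close> trivially.
\<close>

lemma isotropic_sub_bimodule_avoiding:
  assumes R: "sub R" and Q: "sub Q" and "\<not> R \<subseteq> Q"
  obtains P where "sub P" "isotropic \<omega> P" "P \<subseteq> R" "P \<inter> Q = {0}" "P \<noteq> {0}"
proof -
  obtain F :: "'a set set" and u where u: "\<And>L. L \<in> F \<Longrightarrow> minimal_idempotent scaleA (u L)" "1 = sum u F"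
    using one_eq_sum_minimal_idempotents[OF semisimple] by metis
  from assms(3) obtain x where x: "x \<in> R" "x \<notin> Q"
    by blast
  from x(2) obtain i j where ij: "i \<in> F" "j \<in> F" "lact (u i) (ract x (u j)) \<notin> Q"
    by (rule peirce_part_not_in_sub[OF u(2) Q])
  define y where "y = lact (u i) (ract x (u j))"
  have y: "lact (u i) y = y" "ract y (u j) = y"
    using minimal_idempotent_idem[OF u(1)[OF ij(1)]] minimal_idempotent_idem[OF u(1)[OF ij(2)]]
    by (simp_all add: y_def flip: lact_mult lact_ract ract_mult)
  have yR: "y \<in> R" and yQ: "y \<notin> Q"
    using x(1) subD(6,7)[OF R] ij(3) by (auto simp: y_def)
  show thesis
  proof
    show "sub (generated y)"
      by (rule sub_generated)
    show "isotropic \<omega> (generated y)"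
      by (rule isotropic_generated_by_peirce_element[OF u(1)[OF ij(1)] u(1)[OF ij(2)] y])
    show "generated y \<subseteq> R"
      by (rule generated_minimal[OF R yR])
    show "generated y \<inter> Q = {0}"
      using generated_by_peirce_element_simple[OF u(1)[OF ij(1)] u(1)[OF ij(2)] y Q] yQ
        subD(2)[OF Q] subD(2)[OF sub_generated] by blast
    show "generated y \<noteq> {0}"
      using generator_self[of y] yQ subD(2)[OF Q] by auto
  qed
qed

text \<open>
  Otherwise \<open>S\<^sup>\<bottom>\<close> would contain a nonzero isotropic \<open>P\<close> that meets \<open>S\<close> trivially, and \<open>S + P\<close> would
  be a larger isotropic sub-bimodule.
\<close>

lemma maximal_isotropic_lagrangian:
  assumes "maximal_isotropic_sub_bimodule scaleM lact ract \<omega> S"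
  shows "lagrangian \<omega> S"
proof -
  have S: "sub S" "isotropic \<omega> S" and max: "\<And>T. sub T \<Longrightarrow> isotropic \<omega> T \<Longrightarrow> S \<subseteq> T \<Longrightarrow> T = S"
    using assms by (auto simp: maximal_isotropic_sub_bimodule_def)
  have "perp \<omega> S \<subseteq> S"
  proof (rule ccontr)
    assume "\<not> ?thesis"
    then obtain P where P: "sub P" "isotropic \<omega> P" "P \<subseteq> perp \<omega> S" "P \<inter> S = {0}" "P \<noteq> {0}"
      by (rule isotropic_sub_bimodule_avoiding[OF sub_perp[OF S(1)] S(1)])
    have "S \<subseteq> {s + p |s p. s \<in> S \<and> p \<in> P}"
      using subD(2)[OF P(1)] by force
    then have "{s + p |s p. s \<in> S \<and> p \<in> P} = S"
      by (intro max sub_plus isotropic_plus S P)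
    moreover have "P \<subseteq> {s + p |s p. s \<in> S \<and> p \<in> P}"
      using subD(2)[OF S(1)] by force
    ultimately have "P \<subseteq> S" by simp
    with P(4,5) show False by blast
  qed
  with S(2) show ?thesis
    by (auto simp: lagrangian_def isotropic_def)
qed

text \<open>
  The complement is a sub-bimodule \<open>D\<close> of largest dimension among the isotropic ones that meet \<open>S\<close>
  trivially. If \<open>D\<^sup>\<bottom>\<close> were not contained in \<open>S + D\<close>, then \<open>D\<close> could be enlarged inside \<open>D\<^sup>\<bottom>\<close>
  without meeting \<open>S\<close>. So \<open>D\<^sup>\<bottom> \<subseteq> S + D\<close>, and \<open>S + D = M\<close> follows by taking orthogonals.
\<close>

lemma lagrangian_has_isotropic_complement:
  assumes fd: "finite_dim scaleM" and S: "sub S" "lagrangian \<omega> S"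
  obtains D where "sub D" "isotropic \<omega> D" "internal_direct_sum S D"
proof -
  from fd obtain B where "finite_dimensional_vector_space scaleM B"
    by (auto simp: finite_dim_def)
  then interpret V: finite_dimensional_vector_space scaleM B .
  define good where "good D \<longleftrightarrow> sub D \<and> isotropic \<omega> D \<and> D \<inter> S = {0}" for D
  have "good {0}"
    using sub_zero subD(2)[OF S(1)] by (auto simp: good_def isotropic_iff)
  moreover have "\<forall>E. good E \<longrightarrow> M.dim E < Suc V.dimension"
    using V.dim_subset_UNIV by (simp add: less_Suc_eq_le)
  ultimately obtain D where D: "good D" and max: "\<And>E. good E \<Longrightarrow> M.dim E \<le> M.dim D"
    using Lattices_Big.ex_has_greatest_nat[of good "{0}" M.dim "Suc V.dimension"] by blast
  have sD: "sub D" and iD: "isotropic \<omega> D" and DS: "D \<inter> S = {0}"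
    using D by (auto simp: good_def)
  let ?SD = "{s + d |s d. s \<in> S \<and> d \<in> D}"
  have sSD: "sub ?SD"
    by (rule sub_plus[OF S(1) sD])
  have "perp \<omega> D \<subseteq> ?SD"
  proof (rule ccontr)
    assume "\<not> ?thesis"
    then obtain P where P: "sub P" "isotropic \<omega> P" "P \<subseteq> perp \<omega> D" "P \<inter> ?SD = {0}" "P \<noteq> {0}"
      by (rule isotropic_sub_bimodule_avoiding[OF sub_perp[OF sD] sSD])
    let ?E = "{d + p |d p. d \<in> D \<and> p \<in> P}"
    have DE: "D \<subseteq> ?E" and PE: "P \<subseteq> ?E" and DSD: "D \<subseteq> ?SD"
      using subD(2)[OF P(1)] subD(2)[OF sD] subD(2)[OF S(1)] by force+
    have "?E \<inter> S \<subseteq> {0}"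
    proof safe
      fix d p assume d: "d \<in> D" and p: "p \<in> P" and s: "d + p \<in> S"
      have "p = (d + p) + (- d)" by simp
      moreover have "- d \<in> D"
        using subD(4)[OF sD subD(2)[OF sD] d] by simp
      ultimately have "p \<in> ?SD"
        using s by blast
      with p P(4) have "p = 0" by blast
      with d s DS show "d + p = 0" by auto
    qed
    then have "?E \<inter> S = {0}"
      using DE subD(2)[OF sD] subD(2)[OF S(1)] by blast
    then have "good ?E"
      unfolding good_def by (intro conjI sub_plus sD P isotropic_plus iD)
    then have "D = ?E"
      by (intro V.subspace_dim_equal subD(1)[OF sD] subD(1)[OF sub_plus[OF sD P(1)]] DE max)
    with PE have "P \<subseteq> D" by metis
    with DSD have "P \<subseteq> ?SD" by (rule subset_trans[rotated])
    with P(4,5) show False by blast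
  qed
  have "?SD = UNIV"
  proof -
    have "perp \<omega> ?SD \<subseteq> {0}"
    proof
      fix x assume "x \<in> perp \<omega> ?SD"
      moreover have "S \<subseteq> ?SD" "D \<subseteq> ?SD"
        using subD(2)[OF sD] subD(2)[OF S(1)] by force+
      ultimately have xS: "x \<in> perp \<omega> S" and "\<And>z. z \<in> ?SD \<Longrightarrow> \<omega> x z = 0"
        unfolding mem_perp by blast+
      with \<open>perp \<omega> D \<subseteq> ?SD\<close> have "x \<in> perp \<omega> (perp \<omega> D)"
        by (auto simp: mem_perp[of x "perp \<omega> D"])
      then have "x \<in> D"
        using perp_perp_subset[OF fd subD(1)[OF sD]] by blast
      moreover have "x \<in> S"
        using xS S(2) by (simp add: lagrangian_def)
      ultimately show "x \<in> {0}"
        using DS by blast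
    qed
    then have "x \<in> perp \<omega> (perp \<omega> ?SD)" for x
      unfolding mem_perp[of x "perp \<omega> ?SD"] using form_zero(2) by blast
    then show ?thesis
      using perp_perp_subset[OF fd subD(1)[OF sSD]] by blast
  qed
  with DS have "internal_direct_sum S D"
    by (simp add: internal_direct_sum_def Int_commute)
  with sD iD that show thesis by blast
qed

end

theorem theorem2p2:
  fixes scaleA :: "'k::{alg_closed_field, field_char_0} \<Rightarrow> 'a::{ring, monoid_mult} \<Rightarrow> 'a"
    and scaleM :: "'k \<Rightarrow> 'm::ab_group_add \<Rightarrow> 'm"
    and lact :: "'a \<Rightarrow> 'm \<Rightarrow> 'm" and ract :: "'m \<Rightarrow> 'a \<Rightarrow> 'm"
    and \<omega> :: "'m \<Rightarrow> 'm \<Rightarrow> 'k" and S :: "'m set"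
  assumes "assoc_algebra scaleA" and "finite_dim scaleA" and "semisimple_algebra scaleA"
    and "bimodule scaleA scaleM lact ract" and "finite_dim scaleM"
    and "symplectic_form scaleM \<omega>" and "balanced lact ract \<omega>"
    and "maximal_isotropic_sub_bimodule scaleM lact ract \<omega> S"
  shows "(\<exists>D. sub_bimodule scaleM lact ract D \<and> isotropic \<omega> D \<and> internal_direct_sum S D)
    \<and> lagrangian \<omega> S
    \<and> (\<forall>D. sub_bimodule scaleM lact ract D \<and> isotropic \<omega> D \<and> internal_direct_sum S D
          \<longrightarrow> lagrangian \<omega> D)
    \<and> (\<exists>\<phi>. iso_sum_dual scaleM lact ract S \<phi> \<and>
          (\<forall>x x'. case (\<phi> x, \<phi> x') of ((s, f), (s', f')) \<Rightarrow> \<omega> x x' = f s' - f' s))"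
proof -
  interpret bimodule scaleA scaleM lact ract by fact
  interpret semisimple_symplectic_bimodule scaleA scaleM lact ract \<omega>
    by unfold_locales fact+
  have S: "sub S" "lagrangian \<omega> S"
    using assms(8) maximal_isotropic_lagrangian by (auto simp: maximal_isotropic_sub_bimodule_def)
  obtain D where D: "sub D" "isotropic \<omega> D" "internal_direct_sum S D"
    using lagrangian_has_isotropic_complement[OF assms(5) S] by blast
  obtain \<phi> where "iso_sum_dual scaleM lact ract S \<phi>"
    and "\<And>x x'. case (\<phi> x, \<phi> x') of ((s, f), (s', f')) \<Rightarrow> \<omega> x x' = f s' - f' s"
    using iso_sum_dual_of_complement[OF assms(5) S D] by blast
  with S D lagrangian_complement[OF S(2)] show ?thesis
    by blast
qed

end
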